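(* Let $p$ be a prime. For all $P(x)\in\mathcal{R}\otimes_{\mathbb{Z}}\mathbb{F}_p$, we have $\Psi_p\left(S\,\overline{P(x)}\right)=S\,\overline{\Psi_p(P(x))}$.
   Context: $\mathbb{N}=\{0,1,2,\dots\}$. $\mathcal{R}:=\{P(x)\in\mathbb{Q}[x] : P(n)\in\mathbb{Z}\text{ for all }n\in\mathbb{N}\}$ is a free $\mathbb{Z}$-module with basis $\binom{x}{k}:=\frac{x(x-1)\cdots(x-k+1)}{k!}$ ($k\ge1$), $\binom{x}{0}:=1$; the images of these form an $\mathbb{F}_p$-basis of $\mathcal{R}\otimes_{\mathbb{Z}}\mathbb{F}_p$. The Frobenius map $\Psi_p\colon\mathcal{R}\otimes_{\mathbb{Z}}\mathbb{F}_p\to\mathcal{R}\otimes_{\mathbb{Z}}\mathbb{F}_p$ is the $\mathbb{F}_p$-linear map (in fact a ring homomorphism) with $\Psi_p\left(\binom{x}{k}\right)=\binom{x}{pk}$ for all $k\in\mathbb{N}$. The shift operator $S$ and the bar involution $\overline{\;\cdot\;}$ on $\mathcal{R}\otimes_{\mathbb{Z}}\mathbb{F}_p$ are obtained by tensoring with $\mathbb{F}_p$ the ring automorphisms of $\mathcal{R}$ given by $S\colon P(x)\mapsto P(x+1)$ and $\overline{\;\cdot\;}\colon P(x)\mapsto P(-x)$. *)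

theory Defs
  imports
    "HOL-Number_Theory.Residues"
    "HOL-Algebra.Free_Abelian_Groups"
    "HOL-Algebra.QuotRing"
    "HOL-Computational_Algebra.Polynomial"
begin

section \<open>Tensor products over the integers\<close>

text \<open>
  The tensor product over the integers of two commutative rings \<open>A\<close> and \<open>B\<close> is the free
  abelian group on the pairs \<open>(a, b)\<close> modulo the biadditivity relations; balancedness over the
  integers follows from biadditivity. The componentwise product of pairs makes this free abelian
  group a ring in which the subgroup spanned by the relations is an ideal.
\<close>

definition tensor_free ::
    "('a, 'm) ring_scheme \<Rightarrow> ('b, 'n) ring_scheme \<Rightarrow> ('a \<times> 'b \<Rightarrow>\<^sub>0 int) ring" where
  "tensor_free A B =
    \<lparr>carrier = carrier (free_Abelian_group (carrier A \<times> carrier B)),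
     monoid.mult = (\<lambda>c d. frag_extend (\<lambda>(a, b). frag_extend
       (\<lambda>(a', b'). frag_of (a \<otimes>\<^bsub>A\<^esub> a', b \<otimes>\<^bsub>B\<^esub> b')) d) c),
     one = frag_of (\<one>\<^bsub>A\<^esub>, \<one>\<^bsub>B\<^esub>),
     ring.zero = 0,
     add = (+)\<rparr>"

definition tensor_relations ::
    "('a, 'm) ring_scheme \<Rightarrow> ('b, 'n) ring_scheme \<Rightarrow> ('a \<times> 'b \<Rightarrow>\<^sub>0 int) set" where
  "tensor_relations A B =
    {frag_of (a \<oplus>\<^bsub>A\<^esub> a', b) - frag_of (a, b) - frag_of (a', b) | a a' b.
       a \<in> carrier A \<and> a' \<in> carrier A \<and> b \<in> carrier B} \<union>
    {frag_of (a, b \<oplus>\<^bsub>B\<^esub> b') - frag_of (a, b) - frag_of (a, b') | a b b'.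
       a \<in> carrier A \<and> b \<in> carrier B \<and> b' \<in> carrier B}"

definition tensor_ideal ::
    "('a, 'm) ring_scheme \<Rightarrow> ('b, 'n) ring_scheme \<Rightarrow> ('a \<times> 'b \<Rightarrow>\<^sub>0 int) set" where
  "tensor_ideal A B = generate (add_monoid (tensor_free A B)) (tensor_relations A B)"

definition pure_tensor ::
    "('a, 'm) ring_scheme \<Rightarrow> ('b, 'n) ring_scheme \<Rightarrow> 'a \<Rightarrow> 'b \<Rightarrow> ('a \<times> 'b \<Rightarrow>\<^sub>0 int) set" where
  "pure_tensor A B a b = tensor_ideal A B +>\<^bsub>tensor_free A B\<^esub> frag_of (a, b)"

definition tensor_ring ::
    "('a, 'm) ring_scheme \<Rightarrow> ('b, 'n) ring_scheme \<Rightarrow> ('a \<times> 'b \<Rightarrow>\<^sub>0 int) set ring" where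
  "tensor_ring A B = tensor_free A B Quot tensor_ideal A B"

text \<open>The same ring as a \<open>B\<close>-algebra: \<open>b\<close> acts as multiplication by the tensor of \<open>\<one>\<close> and \<open>b\<close>.\<close>

definition tensor_algebra ::
    "('a, 'm) ring_scheme \<Rightarrow> ('b, 'n) ring_scheme \<Rightarrow> ('b, ('a \<times> 'b \<Rightarrow>\<^sub>0 int) set) module" where
  "tensor_algebra A B = ring.extend (tensor_ring A B)
     \<lparr>module.smult = (\<lambda>b X. pure_tensor A B \<one>\<^bsub>A\<^esub> b \<otimes>\<^bsub>tensor_ring A B\<^esub> X)\<rparr>"

text \<open>
  \<open>tensor_map A B f\<close> is the tensor product of an additive map \<open>f\<close> from \<open>A\<close> to \<open>A\<close> with the
  identity of \<open>B\<close>, computed on an arbitrary representative of a coset.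
\<close>

definition tensor_map ::
    "('a, 'm) ring_scheme \<Rightarrow> ('b, 'n) ring_scheme \<Rightarrow> ('a \<Rightarrow> 'a) \<Rightarrow>
      ('a \<times> 'b \<Rightarrow>\<^sub>0 int) set \<Rightarrow> ('a \<times> 'b \<Rightarrow>\<^sub>0 int) set" where
  "tensor_map A B f X = the_elem
     ((\<lambda>c. tensor_ideal A B +>\<^bsub>tensor_free A B\<^esub> frag_extend (\<lambda>(a, b). frag_of (f a, b)) c) ` X)"

definition linear_maps ::
    "('r, 'k) ring_scheme \<Rightarrow> ('r, 'a, 'm) module_scheme \<Rightarrow> ('r, 'b, 'n) module_scheme \<Rightarrow>
      ('a \<Rightarrow> 'b) set" where
  "linear_maps R M N = {f \<in> carrier M \<rightarrow> carrier N.
     (\<forall>x\<in>carrier M. \<forall>y\<in>carrier M. f (x \<oplus>\<^bsub>M\<^esub> y) = f x \<oplus>\<^bsub>N\<^esub> f y) \<and>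
     (\<forall>c\<in>carrier R. \<forall>x\<in>carrier M. f (c \<odot>\<^bsub>M\<^esub> x) = c \<odot>\<^bsub>N\<^esub> f x)}"


section \<open>Integer-valued polynomials\<close>

definition int_valued_ring :: "rat poly ring" where
  "int_valued_ring =
    \<lparr>carrier = {P. \<forall>n::nat. poly P (of_nat n) \<in> \<int>},
     monoid.mult = (*), one = 1, ring.zero = 0, add = (+)\<rparr>"

definition binomial_poly :: "nat \<Rightarrow> rat poly" where
  "binomial_poly k = smult (1 / fact k) (\<Prod>i<k. [:- of_nat i, 1:])"

definition poly_shift :: "rat poly \<Rightarrow> rat poly" where
  "poly_shift P = P \<circ>\<^sub>p [:1, 1:]"

definition poly_bar :: "rat poly \<Rightarrow> rat poly" where
  "poly_bar P = P \<circ>\<^sub>p [:0, -1:]"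


section \<open>Reduction modulo p and the Frobenius map\<close>

text \<open>For a prime \<open>p\<close>, \<open>residue_ring (int p)\<close> is the field with \<open>p\<close> elements.\<close>

abbreviation int_valued_mod :: "nat \<Rightarrow> (int, (rat poly \<times> int \<Rightarrow>\<^sub>0 int) set) module" where
  "int_valued_mod p \<equiv> tensor_algebra int_valued_ring (residue_ring (int p))"

abbreviation reduce_mod :: "nat \<Rightarrow> rat poly \<Rightarrow> (rat poly \<times> int \<Rightarrow>\<^sub>0 int) set" where
  "reduce_mod p P \<equiv> pure_tensor int_valued_ring (residue_ring (int p)) P 1"

definition shift_mod ::
    "nat \<Rightarrow> (rat poly \<times> int \<Rightarrow>\<^sub>0 int) set \<Rightarrow> (rat poly \<times> int \<Rightarrow>\<^sub>0 int) set" where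
  "shift_mod p = tensor_map int_valued_ring (residue_ring (int p)) poly_shift"

definition bar_mod ::
    "nat \<Rightarrow> (rat poly \<times> int \<Rightarrow>\<^sub>0 int) set \<Rightarrow> (rat poly \<times> int \<Rightarrow>\<^sub>0 int) set" where
  "bar_mod p = tensor_map int_valued_ring (residue_ring (int p)) poly_bar"

text \<open>
  The map is pinned down on the carrier only, so it is required to be \<open>undefined\<close> elsewhere;
  existence and uniqueness are \<open>frobenius_ex1\<close> below.
\<close>

definition frobenius_mod ::
    "nat \<Rightarrow> (rat poly \<times> int \<Rightarrow>\<^sub>0 int) set \<Rightarrow> (rat poly \<times> int \<Rightarrow>\<^sub>0 int) set" where
  "frobenius_mod p = (THE \<Psi>.
     \<Psi> \<in> linear_maps (residue_ring (int p)) (int_valued_mod p) (int_valued_mod p) \<and>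
     \<Psi> \<in> extensional (carrier (int_valued_mod p)) \<and>
     (\<forall>k. \<Psi> (reduce_mod p (binomial_poly k)) = reduce_mod p (binomial_poly (p * k))))"


section \<open>Well-definedness\<close>

lemma carrier_tensor_free: "carrier (tensor_free A B) = {c. Poly_Mapping.keys c \<subseteq> carrier A \<times> carrier B}"
  by (simp add: tensor_free_def free_Abelian_group_def)

lemma tensor_free_simps [simp]:
  "\<zero>\<^bsub>tensor_free A B\<^esub> = 0"
  "\<one>\<^bsub>tensor_free A B\<^esub> = frag_of (\<one>\<^bsub>A\<^esub>, \<one>\<^bsub>B\<^esub>)"
  "c \<oplus>\<^bsub>tensor_free A B\<^esub> d = c + d"
  by (simp_all add: tensor_free_def)

lemma tensor_free_mult_of [simp]:
  "frag_of (a, b) \<otimes>\<^bsub>tensor_free A B\<^esub> frag_of (a', b') = frag_of (a \<otimes>\<^bsub>A\<^esub> a', b \<otimes>\<^bsub>B\<^esub> b')"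
  by (simp add: tensor_free_def)

lemma tensor_free_mult_0 [simp]:
  "0 \<otimes>\<^bsub>tensor_free A B\<^esub> d = 0"  "d \<otimes>\<^bsub>tensor_free A B\<^esub> 0 = 0"
  by (simp_all add: tensor_free_def frag_extend_eq_0 split_def)

lemma tensor_free_mult_add:
  "(c + c') \<otimes>\<^bsub>tensor_free A B\<^esub> d = c \<otimes>\<^bsub>tensor_free A B\<^esub> d + c' \<otimes>\<^bsub>tensor_free A B\<^esub> d"
  "(c - c') \<otimes>\<^bsub>tensor_free A B\<^esub> d = c \<otimes>\<^bsub>tensor_free A B\<^esub> d - c' \<otimes>\<^bsub>tensor_free A B\<^esub> d"
  by (simp_all add: tensor_free_def frag_extend_add frag_extend_diff)

lemma frag_extend_add_fun: "frag_extend (\<lambda>x. f x + g x) c = frag_extend f c + frag_extend g c"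
  by (simp add: frag_extend_def frag_cmul_distrib2 sum.distrib)

lemma frag_extend_diff_fun: "frag_extend (\<lambda>x. f x - g x) c = frag_extend f c - frag_extend g c"
  using frag_extend_add_fun[of "\<lambda>x. f x - g x" g c] by simp

lemma tensor_free_mult_add_right:
  "d \<otimes>\<^bsub>tensor_free A B\<^esub> (c + c') = d \<otimes>\<^bsub>tensor_free A B\<^esub> c + d \<otimes>\<^bsub>tensor_free A B\<^esub> c'"
  "d \<otimes>\<^bsub>tensor_free A B\<^esub> (c - c') = d \<otimes>\<^bsub>tensor_free A B\<^esub> c - d \<otimes>\<^bsub>tensor_free A B\<^esub> c'"
  by (simp_all add: tensor_free_def frag_extend_add frag_extend_diff split_def
      frag_extend_add_fun frag_extend_diff_fun)

lemmas tensor_free_distribs = tensor_free_mult_add tensor_free_mult_add_right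

locale two_crings = A: cring A + B: cring B for A (structure) and B (structure)
begin

abbreviation "T \<equiv> tensor_free A B"
abbreviation "I \<equiv> tensor_ideal A B"
abbreviation "Q \<equiv> tensor_ring A B"

lemma frag_of_carrier: "a \<in> carrier A \<Longrightarrow> b \<in> carrier B \<Longrightarrow> frag_of (a, b) \<in> carrier T"
  by (simp add: carrier_tensor_free)

lemma diff_carrier: "c \<in> carrier T \<Longrightarrow> d \<in> carrier T \<Longrightarrow> c - d \<in> carrier T"
  using keys_diff[of c d] by (auto simp: carrier_tensor_free)

lemma add_carrier: "c \<in> carrier T \<Longrightarrow> d \<in> carrier T \<Longrightarrow> c + d \<in> carrier T"
  using keys_add[of c d] by (auto simp: carrier_tensor_free)

lemma uminus_carrier: "c \<in> carrier T \<Longrightarrow> - c \<in> carrier T"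
  by (auto simp: carrier_tensor_free)

lemma zero_carrier: "0 \<in> carrier T"
  by (auto simp: carrier_tensor_free)

lemma T_induct [consumes 1, case_names zero of diff]:
  assumes "c \<in> carrier T" "P 0"
    "\<And>a b. a \<in> carrier A \<Longrightarrow> b \<in> carrier B \<Longrightarrow> P (frag_of (a, b))"
    "\<And>c d. P c \<Longrightarrow> P d \<Longrightarrow> P (c - d)"
  shows "P c"
proof -
  have "Poly_Mapping.keys c \<subseteq> carrier A \<times> carrier B" using assms(1) by (simp add: carrier_tensor_free)
  then show ?thesis by (induction c rule: frag_induction) (use assms in auto)
qed

lemma T_mult_closed:
  assumes "c \<in> carrier T" "d \<in> carrier T" shows "c \<otimes>\<^bsub>T\<^esub> d \<in> carrier T"
  using assms(1)
proof (induction c rule: T_induct)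
  case (of a b)
  show ?case using assms(2)
    by (induction d rule: T_induct)
       (auto simp: tensor_free_distribs zero_carrier of frag_of_carrier intro!: diff_carrier)
qed (auto simp: tensor_free_distribs zero_carrier intro!: diff_carrier)

lemma T_cring: "cring T"
proof (rule cringI)
  show "abelian_group T"
    by (rule abelian_groupI)
       (auto simp: add_carrier zero_carrier uminus_carrier intro!: bexI[of _ "- _"])
  have assoc: "c \<otimes>\<^bsub>T\<^esub> d \<otimes>\<^bsub>T\<^esub> e = c \<otimes>\<^bsub>T\<^esub> (d \<otimes>\<^bsub>T\<^esub> e)"
    if "c \<in> carrier T" "d \<in> carrier T" "e \<in> carrier T" for c d e
    using that(1)
  proof (induction c rule: T_induct)
    case (of a b)
    show ?case using that(2)
    proof (induction d rule: T_induct)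
      case (of a' b')
      show ?case using that(3)
        by (induction e rule: T_induct)
          (use of \<open>a \<in> _\<close> \<open>b \<in> _\<close> in \<open>simp_all add: tensor_free_distribs A.m_assoc B.m_assoc\<close>)
    qed (simp_all add: tensor_free_distribs)
  qed (simp_all add: tensor_free_distribs)
  have comm: "c \<otimes>\<^bsub>T\<^esub> d = d \<otimes>\<^bsub>T\<^esub> c"
    if "c \<in> carrier T" "d \<in> carrier T" for c d
    using that(1)
  proof (induction c rule: T_induct)
    case (of a b)
    show ?case using that(2)
      by (induction d rule: T_induct)
        (use of in \<open>simp_all add: tensor_free_distribs A.m_comm B.m_comm\<close>)
  qed (simp_all add: tensor_free_distribs)
  have one: "\<one>\<^bsub>T\<^esub> \<otimes>\<^bsub>T\<^esub> c = c" if "c \<in> carrier T" for c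
    using that by (induction c rule: T_induct) (simp_all add: tensor_free_distribs)
  show "comm_monoid T"
    by (rule comm_monoidI) (use one comm assoc T_mult_closed frag_of_carrier in auto)
qed (simp add: tensor_free_distribs)

sublocale T: cring T by (rule T_cring)

lemma T_a_inv: "c \<in> carrier T \<Longrightarrow> \<ominus>\<^bsub>T\<^esub> c = - c"
  by (rule T.minus_equality) (auto simp: uminus_carrier)

lemma relations_carrier: "tensor_relations A B \<subseteq> carrier T"
  by (auto simp: tensor_relations_def intro!: diff_carrier frag_of_carrier)

lemma I_subgroup: "subgroup I (add_monoid T)"
  unfolding tensor_ideal_def
  by (rule group.generate_is_subgroup[OF T.a_group]) (use relations_carrier in auto)

lemma I_carrier: "c \<in> I \<Longrightarrow> c \<in> carrier T"
  using subgroup.mem_carrier[OF I_subgroup] by simp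

lemma I_relation: "r \<in> tensor_relations A B \<Longrightarrow> r \<in> I"
  unfolding tensor_ideal_def by (rule generate.incl)

lemma I_zero: "0 \<in> I"
  using subgroup.one_closed[OF I_subgroup] by simp

lemma I_add: "c \<in> I \<Longrightarrow> d \<in> I \<Longrightarrow> c + d \<in> I"
  using subgroup.m_closed[OF I_subgroup] by simp

lemma I_uminus: "c \<in> I \<Longrightarrow> - c \<in> I"
  using subgroup.m_inv_closed[OF I_subgroup, of c] T_a_inv[of c] I_carrier[of c]
  by (simp add: a_inv_def)

lemma I_diff: "c \<in> I \<Longrightarrow> d \<in> I \<Longrightarrow> c - d \<in> I"
  using I_add[of c "- d"] I_uminus by simp

lemma I_induct [consumes 1, case_names zero left right diff]:
  assumes "c \<in> I" "P 0"
    "\<And>a a' b. a \<in> carrier A \<Longrightarrow> a' \<in> carrier A \<Longrightarrow> b \<in> carrier B \<Longrightarrow>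
       P (frag_of (a \<oplus>\<^bsub>A\<^esub> a', b) - frag_of (a, b) - frag_of (a', b))"
    "\<And>a b b'. a \<in> carrier A \<Longrightarrow> b \<in> carrier B \<Longrightarrow> b' \<in> carrier B \<Longrightarrow>
       P (frag_of (a, b \<oplus>\<^bsub>B\<^esub> b') - frag_of (a, b) - frag_of (a, b'))"
    and diff: "\<And>c d. P c \<Longrightarrow> P d \<Longrightarrow> P (c - d)"
  shows "P c"
proof -
  have rel: "P r" if "r \<in> tensor_relations A B" for r
    using that assms(3,4) unfolding tensor_relations_def by blast
  have neg: "P (- x)" if "P x" for x using diff[OF assms(2) that] by simp
  have "c \<in> generate (add_monoid T) (tensor_relations A B)"
    using assms(1) by (simp add: tensor_ideal_def)
  then show ?thesis
  proof induction
    case one then show ?case using assms(2) by simp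
  next
    case (incl h) then show ?case by (rule rel)
  next
    case (inv h)
    then have "inv\<^bsub>add_monoid T\<^esub> h = - h"
      using T_a_inv[of h] relations_carrier by (auto simp: a_inv_def)
    then show ?case using neg[OF rel[OF inv]] by simp
  next
    case (eng h1 h2)
    then show ?case using diff[OF eng.IH(1) neg[OF eng.IH(2)]] by simp
  qed
qed

lemma I_left_mult:
  assumes "c \<in> I" "d \<in> carrier T" shows "d \<otimes>\<^bsub>T\<^esub> c \<in> I"
  using assms(2)
proof (induction d rule: T_induct)
  case (of x y)
  show ?case using assms(1)
  proof (induction c rule: I_induct)
    case (left a a' b)
    show ?case unfolding tensor_free_distribs tensor_free_mult_of
      by (rule I_relation) (use of left in \<open>force simp: tensor_relations_def A.r_distr\<close>)
  next
    case (right a b b')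
    show ?case unfolding tensor_free_distribs tensor_free_mult_of
      by (rule I_relation, unfold tensor_relations_def, rule UnI2)
         (use of right in \<open>force simp: B.r_distr\<close>)
  qed (auto simp: tensor_free_distribs I_zero intro: I_diff)
qed (auto simp: tensor_free_distribs I_zero intro: I_diff)

lemma I_ideal: "ideal I T"
proof (rule idealI)
  fix a x assume "a \<in> I" "x \<in> carrier T"
  then show "x \<otimes>\<^bsub>T\<^esub> a \<in> I" "a \<otimes>\<^bsub>T\<^esub> x \<in> I"
    using I_left_mult[of a x] T.m_comm[of a x] I_carrier by auto
qed (rule T.ring_axioms I_subgroup)+

sublocale I: ideal I T by (rule I_ideal)

sublocale Q: cring Q
  unfolding tensor_ring_def by (rule I.quotient_is_cring) (rule T_cring)

abbreviation coset :: "_ \<Rightarrow> _" where "coset c \<equiv> I +>\<^bsub>T\<^esub> c"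

lemma coset_eq_iff:
  assumes "c \<in> carrier T" "d \<in> carrier T"
  shows "coset c = coset d \<longleftrightarrow> c - d \<in> I"
proof -
  have "c \<ominus>\<^bsub>T\<^esub> d = c - d" using assms by (simp add: T.minus_eq T_a_inv)
  then show ?thesis using assms
    by (metis I.a_repr_independence' I.a_repr_independenceD I.a_rcos_module_minus T.ring_axioms)
qed

lemma Q_carrier: "carrier Q = coset ` carrier T"
  by (auto simp: tensor_ring_def FactRing_def A_RCOSETS_def')

lemma Q_zero: "\<zero>\<^bsub>Q\<^esub> = coset 0"
  using I.a_rcos_const[OF I_zero] by (simp add: tensor_ring_def FactRing_def)

lemma Q_one: "\<one>\<^bsub>Q\<^esub> = coset (frag_of (\<one>\<^bsub>A\<^esub>, \<one>\<^bsub>B\<^esub>))"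
  by (simp add: tensor_ring_def FactRing_def)

lemma Q_add: "c \<in> carrier T \<Longrightarrow> d \<in> carrier T \<Longrightarrow> coset c \<oplus>\<^bsub>Q\<^esub> coset d = coset (c + d)"
  by (simp add: tensor_ring_def FactRing_def I.a_rcos_sum)

lemma Q_mult: "c \<in> carrier T \<Longrightarrow> d \<in> carrier T \<Longrightarrow> coset c \<otimes>\<^bsub>Q\<^esub> coset d = coset (c \<otimes>\<^bsub>T\<^esub> d)"
  by (simp add: tensor_ring_def FactRing_def I.rcoset_mult_add)

lemma pure_carrier: "a \<in> carrier A \<Longrightarrow> b \<in> carrier B \<Longrightarrow> pure_tensor A B a b \<in> carrier Q"
  by (auto simp: pure_tensor_def Q_carrier frag_of_carrier)

lemma pure_add_left:
  assumes "a \<in> carrier A" "a' \<in> carrier A" "b \<in> carrier B"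
  shows "pure_tensor A B (a \<oplus>\<^bsub>A\<^esub> a') b = pure_tensor A B a b \<oplus>\<^bsub>Q\<^esub> pure_tensor A B a' b"
proof -
  have "frag_of (a \<oplus>\<^bsub>A\<^esub> a', b) - (frag_of (a, b) + frag_of (a', b)) \<in> I"
    by (rule I_relation) (use assms in \<open>force simp: tensor_relations_def\<close>)
  then show ?thesis unfolding pure_tensor_def
    using assms by (simp add: Q_add frag_of_carrier coset_eq_iff add_carrier)
qed

lemma pure_add_right:
  assumes "a \<in> carrier A" "b \<in> carrier B" "b' \<in> carrier B"
  shows "pure_tensor A B a (b \<oplus>\<^bsub>B\<^esub> b') = pure_tensor A B a b \<oplus>\<^bsub>Q\<^esub> pure_tensor A B a b'"
proof -
  have "frag_of (a, b \<oplus>\<^bsub>B\<^esub> b') - (frag_of (a, b) + frag_of (a, b')) \<in> I"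
    by (rule I_relation, unfold tensor_relations_def, rule UnI2)
       (use assms in \<open>force simp: diff_diff_eq\<close>)
  then show ?thesis unfolding pure_tensor_def
    using assms by (simp add: Q_add frag_of_carrier coset_eq_iff add_carrier)
qed

lemma pure_mult:
  assumes "a \<in> carrier A" "a' \<in> carrier A" "b \<in> carrier B" "b' \<in> carrier B"
  shows "pure_tensor A B a b \<otimes>\<^bsub>Q\<^esub> pure_tensor A B a' b' = pure_tensor A B (a \<otimes>\<^bsub>A\<^esub> a') (b \<otimes>\<^bsub>B\<^esub> b')"
  using assms by (simp add: pure_tensor_def Q_mult frag_of_carrier)

lemma Q_induct [consumes 1, case_names zero pure diff]:
  assumes "X \<in> carrier Q" "P \<zero>\<^bsub>Q\<^esub>"
    "\<And>a b. a \<in> carrier A \<Longrightarrow> b \<in> carrier B \<Longrightarrow> P (pure_tensor A B a b)"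
    "\<And>X Y. X \<in> carrier Q \<Longrightarrow> Y \<in> carrier Q \<Longrightarrow> P X \<Longrightarrow> P Y \<Longrightarrow> P (X \<ominus>\<^bsub>Q\<^esub> Y)"
  shows "P X"
proof -
  obtain c where c: "c \<in> carrier T" "X = coset c" using assms(1) by (auto simp: Q_carrier)
  have "c \<in> carrier T \<and> P (coset c)" using c(1)
  proof (induction c rule: T_induct)
    case zero then show ?case using assms(2) by (simp add: Q_zero zero_carrier)
  next
    case (of a b) then show ?case using assms(3) by (simp add: pure_tensor_def frag_of_carrier)
  next
    case (diff c d)
    have "coset (c - d) \<oplus>\<^bsub>Q\<^esub> coset d = coset c"
      using diff by (simp add: Q_add diff_carrier)
    then have "coset c \<ominus>\<^bsub>Q\<^esub> coset d = coset (c - d)"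
      using diff diff_carrier[of c d]
      by (metis (no_types, lifting) Q.add.inv_solve_right Q_carrier a_minus_def imageI)
    then show ?case using diff assms(4)[of "coset c" "coset d"] by (simp add: diff_carrier Q_carrier)
  qed
  then show ?thesis using c by simp
qed

lemma tensor_algebra_simps:
  "carrier (tensor_algebra A B) = carrier Q"
  "add (tensor_algebra A B) = add Q"
  "monoid.mult (tensor_algebra A B) = monoid.mult Q"
  "one (tensor_algebra A B) = one Q"
  "ring.zero (tensor_algebra A B) = ring.zero Q"
  "b \<odot>\<^bsub>tensor_algebra A B\<^esub> X = pure_tensor A B \<one>\<^bsub>A\<^esub> b \<otimes>\<^bsub>Q\<^esub> X"
  by (simp_all add: tensor_algebra_def ring.defs)

lemma tensor_algebra: "algebra B (tensor_algebra A B)"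
proof -
  have [simp]: "pure_tensor A B \<one>\<^bsub>A\<^esub> \<one>\<^bsub>B\<^esub> = \<one>\<^bsub>Q\<^esub>" by (simp add: pure_tensor_def Q_one)
  have m: "pure_tensor A B \<one>\<^bsub>A\<^esub> (a \<otimes>\<^bsub>B\<^esub> b) = pure_tensor A B \<one>\<^bsub>A\<^esub> a \<otimes>\<^bsub>Q\<^esub> pure_tensor A B \<one>\<^bsub>A\<^esub> b"
    if "a \<in> carrier B" "b \<in> carrier B" for a b
    using that by (simp add: pure_mult)
  show ?thesis
  proof (rule algebraI)
  show "cring (tensor_algebra A B)"
  proof (rule cringI)
    show "abelian_group (tensor_algebra A B)"
      by (rule abelian_groupI, unfold tensor_algebra_simps)
        (rule Q.a_closed Q.zero_closed Q.a_assoc Q.a_comm Q.l_zero bexI[where x = "\<ominus>\<^bsub>Q\<^esub> _"] Q.l_neg Q.a_inv_closed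
          | assumption)+
    show "comm_monoid (tensor_algebra A B)"
      by (rule comm_monoidI, unfold tensor_algebra_simps)
        (rule Q.m_closed Q.one_closed Q.m_assoc Q.m_comm Q.l_one | assumption)+
  qed (simp add: tensor_algebra_simps Q.l_distr)
  qed (auto simp: tensor_algebra_simps pure_carrier pure_add_right Q.l_distr Q.r_distr Q.m_assoc m
      intro: B.is_cring)
qed

lemma coset_eqI_mem: "c \<in> carrier T \<Longrightarrow> x \<in> coset c \<Longrightarrow> x \<in> carrier T \<and> x - c \<in> I"
  by (auto simp: a_r_coset_def r_coset_def I_carrier add_carrier)

context
  fixes f
  assumes f_closed: "\<And>a. a \<in> carrier A \<Longrightarrow> f a \<in> carrier A"
    and f_add: "\<And>a a'. a \<in> carrier A \<Longrightarrow> a' \<in> carrier A \<Longrightarrow> f (a \<oplus>\<^bsub>A\<^esub> a') = f a \<oplus>\<^bsub>A\<^esub> f a'"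
begin

private abbreviation "fe \<equiv> frag_extend (\<lambda>(a, b). frag_of (f a, b))"

private lemma fe_carrier: "c \<in> carrier T \<Longrightarrow> fe c \<in> carrier T"
  by (induction c rule: T_induct)
     (auto simp: frag_extend_diff zero_carrier f_closed intro: diff_carrier frag_of_carrier)

private lemma fe_I: "c \<in> I \<Longrightarrow> fe c \<in> I"
proof (induction c rule: I_induct)
  case (left a a' b)
  then show ?case
    unfolding frag_extend_diff frag_extend_of split_conv
    by (intro I_relation, unfold tensor_relations_def, intro UnI1)
       (use f_closed f_add in force)
next
  case (right a b b')
  then show ?case
    unfolding frag_extend_diff frag_extend_of split_conv
    by (intro I_relation, unfold tensor_relations_def, intro UnI2)
       (use f_closed in force)
qed (auto simp: frag_extend_diff I_zero intro: I_diff)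

lemma tensor_map_coset:
  assumes "c \<in> carrier T"
  shows "tensor_map A B f (coset c) = coset (fe c)"
  unfolding tensor_map_def
proof (rule the_elem_image_unique)
  show "coset c \<noteq> {}" using I.a_rcos_self[OF assms] by auto
next
  fix x assume "x \<in> coset c"
  then have x: "x \<in> carrier T" "x - c \<in> I" using coset_eqI_mem assms by auto
  then show "coset (fe x) = coset (fe c)"
    using fe_I[OF x(2)] assms by (simp add: coset_eq_iff fe_carrier frag_extend_diff)
qed

lemma tensor_map_pure:
  "a \<in> carrier A \<Longrightarrow> b \<in> carrier B \<Longrightarrow> tensor_map A B f (pure_tensor A B a b) = pure_tensor A B (f a) b"
  by (simp add: pure_tensor_def tensor_map_coset frag_of_carrier)

lemma tensor_map_closed: "X \<in> carrier Q \<Longrightarrow> tensor_map A B f X \<in> carrier Q"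
  by (auto simp: Q_carrier tensor_map_coset fe_carrier)

lemma tensor_map_add:
  "X \<in> carrier Q \<Longrightarrow> Y \<in> carrier Q \<Longrightarrow>
    tensor_map A B f (X \<oplus>\<^bsub>Q\<^esub> Y) = tensor_map A B f X \<oplus>\<^bsub>Q\<^esub> tensor_map A B f Y"
  by (auto simp: Q_carrier tensor_map_coset fe_carrier Q_add add_carrier frag_extend_add)

end

lemma additive_minus:
  assumes "h \<in> carrier Q \<rightarrow> carrier Q"
    and "\<And>X Y. X \<in> carrier Q \<Longrightarrow> Y \<in> carrier Q \<Longrightarrow> h (X \<oplus>\<^bsub>Q\<^esub> Y) = h X \<oplus>\<^bsub>Q\<^esub> h Y"
  shows "h \<zero>\<^bsub>Q\<^esub> = \<zero>\<^bsub>Q\<^esub>"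
    and "X \<in> carrier Q \<Longrightarrow> Y \<in> carrier Q \<Longrightarrow> h (X \<ominus>\<^bsub>Q\<^esub> Y) = h X \<ominus>\<^bsub>Q\<^esub> h Y"
proof -
  have "group_hom (add_monoid Q) (add_monoid Q) h"
    by (rule group_hom.intro[OF Q.a_group Q.a_group], unfold group_hom_axioms_def)
       (use assms in \<open>auto simp: hom_def\<close>)
  then interpret h: group_hom "add_monoid Q" "add_monoid Q" h .
  show "h \<zero>\<^bsub>Q\<^esub> = \<zero>\<^bsub>Q\<^esub>" using h.hom_one by simp
  show "h (X \<ominus>\<^bsub>Q\<^esub> Y) = h X \<ominus>\<^bsub>Q\<^esub> h Y" if "X \<in> carrier Q" "Y \<in> carrier Q"
    using that assms h.hom_inv[of Y] Q.a_inv_closed[of Y] by (simp add: a_minus_def a_inv_def)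
qed

lemma additive_eqI:
  assumes "h \<in> carrier Q \<rightarrow> carrier Q" "g \<in> carrier Q \<rightarrow> carrier Q"
    and "\<And>X Y. X \<in> carrier Q \<Longrightarrow> Y \<in> carrier Q \<Longrightarrow> h (X \<oplus>\<^bsub>Q\<^esub> Y) = h X \<oplus>\<^bsub>Q\<^esub> h Y"
    and "\<And>X Y. X \<in> carrier Q \<Longrightarrow> Y \<in> carrier Q \<Longrightarrow> g (X \<oplus>\<^bsub>Q\<^esub> Y) = g X \<oplus>\<^bsub>Q\<^esub> g Y"
    and "\<And>a b. a \<in> carrier A \<Longrightarrow> b \<in> carrier B \<Longrightarrow> h (pure_tensor A B a b) = g (pure_tensor A B a b)"
    and "X \<in> carrier Q"
  shows "h X = g X"
  using assms(6)
  by (induction X rule: Q_induct)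
     (simp_all add: assms(5) additive_minus[OF assms(1,3)] additive_minus[OF assms(2,4)])

lemma tensor_map_linear:
  assumes f_closed: "\<And>a. a \<in> carrier A \<Longrightarrow> f a \<in> carrier A"
    and f_add: "\<And>a a'. a \<in> carrier A \<Longrightarrow> a' \<in> carrier A \<Longrightarrow> f (a \<oplus>\<^bsub>A\<^esub> a') = f a \<oplus>\<^bsub>A\<^esub> f a'"
  shows "tensor_map A B f \<in> linear_maps B (tensor_algebra A B) (tensor_algebra A B)"
proof -
  have "tensor_map A B f (pure_tensor A B \<one>\<^bsub>A\<^esub> c \<otimes>\<^bsub>Q\<^esub> X) =
      pure_tensor A B \<one>\<^bsub>A\<^esub> c \<otimes>\<^bsub>Q\<^esub> tensor_map A B f X"
    if "c \<in> carrier B" "X \<in> carrier Q" for c X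
    by (rule additive_eqI[OF _ _ _ _ _ that(2)])
       (use that in \<open>auto simp: tensor_map_closed[OF assms] tensor_map_add[OF assms] f_closed
          tensor_map_pure[OF assms] pure_carrier pure_mult Q.r_distr\<close>)
  then show ?thesis
    by (auto simp: linear_maps_def tensor_algebra_simps tensor_map_closed[OF assms] tensor_map_add[OF assms])
qed

end

subsection \<open>The basis of binomial polynomials\<close>

lemma int_valued_simps [simp]:
  "\<zero>\<^bsub>int_valued_ring\<^esub> = 0"
  "\<one>\<^bsub>int_valued_ring\<^esub> = 1"
  "P \<oplus>\<^bsub>int_valued_ring\<^esub> R = P + R"
  "P \<otimes>\<^bsub>int_valued_ring\<^esub> R = P * R"
  by (simp_all add: int_valued_ring_def)

lemma int_valued_iff: "P \<in> carrier int_valued_ring \<longleftrightarrow> (\<forall>n::nat. poly P (of_nat n) \<in> \<int>)"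
  by (simp add: int_valued_ring_def)

lemma int_valued_cring: "cring int_valued_ring"
proof (rule cringI)
  show "abelian_group int_valued_ring"
    by (rule abelian_groupI) (auto simp: int_valued_iff algebra_simps intro!: bexI[of _ "- _"])
  show "comm_monoid int_valued_ring"
    by (rule comm_monoidI) (auto simp: int_valued_iff algebra_simps)
qed (auto simp: algebra_simps)

lemma binomial_poly_0 [simp]: "binomial_poly 0 = 1"
  by (simp add: binomial_poly_def)

lemma poly_binomial_poly: "poly (binomial_poly k) x = x gchoose k"
  by (simp add: binomial_poly_def poly_prod gbinomial_prod_rev atLeast0LessThan)

lemma binomial_poly_int_valued: "binomial_poly k \<in> carrier int_valued_ring"
  by (auto simp: int_valued_iff poly_binomial_poly simp flip: binomial_gbinomial)

lemma degree_binomial_poly: "degree (binomial_poly k) = k"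
  by (simp add: binomial_poly_def degree_prod_eq_sum_degree)

lemma poly_shift_int_valued: "P \<in> carrier int_valued_ring \<Longrightarrow> poly_shift P \<in> carrier int_valued_ring"
proof -
  assume "P \<in> carrier int_valued_ring"
  then have "poly P (of_nat (Suc n)) \<in> \<int>" for n unfolding int_valued_iff by blast
  then show ?thesis by (simp add: int_valued_iff poly_shift_def poly_pcompose)
qed

definition fdiff :: "rat poly \<Rightarrow> rat poly" where
  "fdiff P = poly_shift P - P"

definition newton_coeff :: "nat \<Rightarrow> rat poly \<Rightarrow> rat" where
  "newton_coeff k P = poly ((fdiff ^^ k) P) 0"

lemma fdiff_simps:
  "fdiff (P + R) = fdiff P + fdiff R"
  "fdiff (smult c P) = smult c (fdiff P)"
  "fdiff 0 = 0"
  by (simp_all add: fdiff_def poly_shift_def pcompose_add pcompose_smult smult_diff_right)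

lemma fdiff_binomial_poly: "fdiff (binomial_poly k) = (if k = 0 then 0 else binomial_poly (k - 1))"
proof (cases k)
  case (Suc j)
  have "poly (fdiff (binomial_poly k)) x = poly (binomial_poly j) x" for x
    using gbinomial_Suc_Suc[of x j]
    by (simp add: Suc fdiff_def poly_shift_def poly_pcompose poly_binomial_poly add.commute)
  then have "fdiff (binomial_poly k) = binomial_poly j"
    by (intro poly_eq_poly_eq_iff[THEN iffD1] ext)
  then show ?thesis using Suc by simp
qed (simp add: fdiff_def poly_shift_def one_pCons pcompose_pCons)

lemma newton_coeff_add: "newton_coeff k (P + R) = newton_coeff k P + newton_coeff k R"
proof -
  have "(fdiff ^^ k) (P + R) = (fdiff ^^ k) P + (fdiff ^^ k) R"
    by (induction k) (simp_all add: fdiff_simps)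
  then show ?thesis by (simp add: newton_coeff_def)
qed

lemma newton_coeff_smult: "newton_coeff k (smult c P) = c * newton_coeff k P"
proof -
  have "(fdiff ^^ k) (smult c P) = smult c ((fdiff ^^ k) P)"
    by (induction k) (simp_all add: fdiff_simps)
  then show ?thesis by (simp add: newton_coeff_def)
qed

lemma newton_coeff_0: "newton_coeff k 0 = 0"
  using newton_coeff_smult[of k 0 0] by simp

lemma newton_coeff_sum: "newton_coeff k (sum f S) = (\<Sum>j\<in>S. newton_coeff k (f j))"
  by (induction S rule: infinite_finite_induct) (simp_all add: newton_coeff_0 newton_coeff_add)

lemma newton_coeff_binomial_poly: "newton_coeff k (binomial_poly j) = (if k = j then 1 else 0)"
proof -
  have "(fdiff ^^ k) (binomial_poly j) = (if k \<le> j then binomial_poly (j - k) else 0)"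
    by (induction k) (auto simp: fdiff_binomial_poly fdiff_simps simp del: binomial_poly_0)
  then show ?thesis
    by (cases "j - k") (auto simp: newton_coeff_def poly_binomial_poly)
qed

lemma newton_coeff_Ints:
  assumes "P \<in> carrier int_valued_ring" shows "newton_coeff k P \<in> \<int>"
proof -
  have "(fdiff ^^ k) P \<in> carrier int_valued_ring"
  proof (induction k)
    case (Suc k)
    then show ?case using poly_shift_int_valued[OF Suc] by (auto simp: fdiff_def int_valued_iff)
  qed (simp add: assms)
  then show ?thesis unfolding newton_coeff_def int_valued_iff by (metis of_nat_0)
qed

lemma binomial_poly_span: "degree P \<le> n \<Longrightarrow> \<exists>c. P = (\<Sum>k\<le>n. smult (c k) (binomial_poly k))"
proof (induction n arbitrary: P)
  case 0
  then obtain a where "P = [:a:]" using degree_eq_zeroE by blast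
  then show ?case by (auto intro!: exI[of _ "\<lambda>_. a"])
next
  case (Suc n)
  let ?b = "binomial_poly (Suc n)"
  have lc: "lead_coeff ?b \<noteq> 0" using degree_binomial_poly[of "Suc n"] by (metis degree_0 leading_coeff_0_iff nat.simps(3))
  define a where "a = coeff P (Suc n) / lead_coeff ?b"
  have "coeff (P - smult a ?b) m = 0" if "m > n" for m
  proof (cases "m = Suc n")
    case True then show ?thesis using lc by (simp add: a_def degree_binomial_poly)
  next
    case False
    then have "m > Suc n" using that by simp
    then show ?thesis using Suc.prems by (simp add: coeff_eq_0 degree_binomial_poly)
  qed
  then have "degree (P - smult a ?b) \<le> n" by (simp add: degree_le)
  then obtain c where c: "P - smult a ?b = (\<Sum>k\<le>n. smult (c k) (binomial_poly k))"
    using Suc.IH by blast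
  have "P = (\<Sum>k\<le>Suc n. smult ((c(Suc n := a)) k) (binomial_poly k))"
    using c by (simp add: algebra_simps)
  then show ?case by blast
qed

lemma newton_expansion:
  assumes "degree P \<le> n"
  shows "P = (\<Sum>k\<le>n. smult (newton_coeff k P) (binomial_poly k))"
proof -
  obtain c where c: "P = (\<Sum>k\<le>n. smult (c k) (binomial_poly k))"
    using binomial_poly_span[OF assms] by blast
  have "newton_coeff j (\<Sum>k\<le>n. smult (c k) (binomial_poly k)) = c j" if "j \<le> n" for j
    using that
    by (simp add: newton_coeff_sum newton_coeff_smult newton_coeff_binomial_poly if_distrib sum.delta cong: if_cong)
  then have "newton_coeff j P = c j" if "j \<le> n" for j using that c by simp
  then show ?thesis using c by simp
qed

lemma newton_coeff_eq_0:
  assumes "degree P < j" shows "newton_coeff j P = 0"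
proof -
  have "newton_coeff j P = newton_coeff j (\<Sum>k\<le>degree P. smult (newton_coeff k P) (binomial_poly k))"
    by (simp add: newton_expansion[OF order_refl, symmetric])
  also have "\<dots> = 0"
    using assms by (simp add: newton_coeff_sum newton_coeff_smult newton_coeff_binomial_poly if_distrib
        sum.delta cong: if_cong)
  finally show ?thesis .
qed

lemma int_valued_sum:
  assumes "\<And>k. k \<in> S \<Longrightarrow> c k \<in> \<int>" "\<And>k. k \<in> S \<Longrightarrow> F k \<in> carrier int_valued_ring"
  shows "(\<Sum>k\<in>S. smult (c k) (F k)) \<in> carrier int_valued_ring"
  using assms by (auto simp: int_valued_iff poly_sum intro!: Ints_mult)

lemma poly_bar_int_valued:
  assumes "P \<in> carrier int_valued_ring" shows "poly_bar P \<in> carrier int_valued_ring"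
proof -
  have Z: "poly (binomial_poly k) (- of_nat n) \<in> \<int>" for k n
  proof (cases k)
    case (Suc j)
    have "- rat_of_nat n gchoose k = (-1) ^ k * (rat_of_nat (n + j) gchoose k)"
      by (subst gbinomial_negated_upper) (simp add: Suc algebra_simps)
    also have "rat_of_nat (n + j) gchoose k = of_nat ((n + j) choose k)"
      by (simp only: binomial_gbinomial)
    finally show ?thesis by (simp add: poly_binomial_poly)
  qed auto
  have "poly (\<Sum>k\<le>degree P. smult (newton_coeff k P) (binomial_poly k)) (- of_nat n) \<in> \<int>" for n
    by (auto simp: poly_sum intro!: Ints_sum Ints_mult Z newton_coeff_Ints assms)
  then have "poly P (- of_nat n) \<in> \<int>" for n
    by (simp add: newton_expansion[OF order_refl, symmetric])
  then show ?thesis by (simp add: int_valued_iff poly_bar_def poly_pcompose)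
qed

lemma poly_shift_add: "poly_shift (P + R) = poly_shift P + poly_shift R"
  by (simp add: poly_shift_def pcompose_add)

lemma poly_bar_add: "poly_bar (P + R) = poly_bar P + poly_bar R"
  by (simp add: poly_bar_def pcompose_add)


subsection \<open>Existence and uniqueness of the Frobenius map\<close>

definition frobenius_lift :: "nat \<Rightarrow> rat poly \<Rightarrow> rat poly" where
  "frobenius_lift p P = (\<Sum>k\<le>degree P. smult (newton_coeff k P) (binomial_poly (p * k)))"

lemma frobenius_lift_eq:
  assumes "degree P \<le> n"
  shows "frobenius_lift p P = (\<Sum>k\<le>n. smult (newton_coeff k P) (binomial_poly (p * k)))"
  unfolding frobenius_lift_def
  by (rule sum.mono_neutral_left) (use assms newton_coeff_eq_0 in auto)

lemma frobenius_lift_add: "frobenius_lift p (P + R) = frobenius_lift p P + frobenius_lift p R"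
proof -
  let ?n = "max (degree P) (degree R)"
  have "degree (P + R) \<le> ?n" by (rule degree_add_le_max)
  then show ?thesis
    by (simp add: frobenius_lift_eq[of _ ?n] newton_coeff_add smult_add_left sum.distrib)
qed

lemma frobenius_lift_int_valued:
  "P \<in> carrier int_valued_ring \<Longrightarrow> frobenius_lift p P \<in> carrier int_valued_ring"
  unfolding frobenius_lift_def by (intro int_valued_sum newton_coeff_Ints binomial_poly_int_valued)

lemma frobenius_lift_binomial_poly: "frobenius_lift p (binomial_poly k) = binomial_poly (p * k)"
  by (simp add: frobenius_lift_def degree_binomial_poly newton_coeff_binomial_poly if_distrib
      [of "\<lambda>c. smult c _"] sum.delta cong: if_cong)

context
  fixes p :: nat
  assumes p: "prime p"
begin

lemma two_crings_mod: "two_crings int_valued_ring (residue_ring (int p))"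
proof -
  have "residues (int p)" using p prime_gt_1_nat[of p] by (simp add: residues_def)
  then show ?thesis using residues.cring int_valued_cring by (simp add: two_crings_def)
qed

interpretation two_crings int_valued_ring "residue_ring (int p)" by (rule two_crings_mod)

lemma one_Fp: "\<one>\<^bsub>residue_ring (int p)\<^esub> = 1" by (simp add: residue_ring_def)

lemma one_Fp_carrier: "1 \<in> carrier (residue_ring (int p))" using B.one_closed by (simp add: one_Fp)

lemma linear_eqI:
  assumes h: "h \<in> linear_maps (residue_ring (int p)) (int_valued_mod p) (int_valued_mod p)"
    and g: "g \<in> linear_maps (residue_ring (int p)) (int_valued_mod p) (int_valued_mod p)"
    and eq: "\<And>k. h (reduce_mod p (binomial_poly k)) = g (reduce_mod p (binomial_poly k))"
    and X: "X \<in> carrier (int_valued_mod p)"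
  shows "h X = g X"
proof -
  have add: "h (X \<oplus>\<^bsub>Q\<^esub> Y) = h X \<oplus>\<^bsub>Q\<^esub> h Y" "g (X \<oplus>\<^bsub>Q\<^esub> Y) = g X \<oplus>\<^bsub>Q\<^esub> g Y"
    if "X \<in> carrier Q" "Y \<in> carrier Q" for X Y
    using h g that by (auto simp: linear_maps_def tensor_algebra_simps)
  have mem: "h \<in> carrier Q \<rightarrow> carrier Q" "g \<in> carrier Q \<rightarrow> carrier Q"
    using h g by (auto simp: linear_maps_def tensor_algebra_simps)
  have scale: "h (pure_tensor int_valued_ring (residue_ring (int p)) 1 c \<otimes>\<^bsub>Q\<^esub> X) = pure_tensor int_valued_ring (residue_ring (int p)) 1 c \<otimes>\<^bsub>Q\<^esub> h X"
    "g (pure_tensor int_valued_ring (residue_ring (int p)) 1 c \<otimes>\<^bsub>Q\<^esub> X) = pure_tensor int_valued_ring (residue_ring (int p)) 1 c \<otimes>\<^bsub>Q\<^esub> g X"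
    if "c \<in> carrier (residue_ring (int p))" "X \<in> carrier Q" for c X
    using h g that by (auto simp: linear_maps_def tensor_algebra_simps)
  define S where "S = {P \<in> carrier int_valued_ring. h (reduce_mod p P) = g (reduce_mod p P)}"
  have S_add: "P + R \<in> S" if "P \<in> S" "R \<in> S" for P R
    using that A.a_closed[of P R] pure_add_left[of P R 1] add pure_carrier one_Fp_carrier
    by (simp add: S_def)
  have S_diff: "P - R \<in> S" if "P \<in> S" "R \<in> S" for P R
  proof -
    have P: "P \<in> carrier int_valued_ring" "R \<in> carrier int_valued_ring" using that by (auto simp: S_def)
    then have D: "P - R \<in> carrier int_valued_ring" by (auto simp: int_valued_iff)
    have e: "reduce_mod p P = reduce_mod p (P - R) \<oplus>\<^bsub>Q\<^esub> reduce_mod p R"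
      using pure_add_left[of "P - R" R 1] D P one_Fp_carrier by simp
    have c: "reduce_mod p (P - R) \<in> carrier Q" "reduce_mod p R \<in> carrier Q"
      using D P one_Fp_carrier pure_carrier by auto
    have "h (reduce_mod p (P - R)) \<oplus>\<^bsub>Q\<^esub> h (reduce_mod p R) =
          g (reduce_mod p (P - R)) \<oplus>\<^bsub>Q\<^esub> h (reduce_mod p R)"
      using that e add[OF c] by (simp add: S_def)
    moreover have "h (reduce_mod p (P - R)) \<in> carrier Q" "g (reduce_mod p (P - R)) \<in> carrier Q"
      "h (reduce_mod p R) \<in> carrier Q" using mem c by auto
    ultimately have "h (reduce_mod p (P - R)) = g (reduce_mod p (P - R))"
      using Q.add.right_cancel by blast
    then show ?thesis using D by (simp add: S_def)
  qed
  have S_binom: "binomial_poly k \<in> S" for k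
    by (simp add: S_def eq binomial_poly_int_valued)
  have S_0: "0 \<in> S" using S_diff[OF S_binom[of 0] S_binom[of 0]] by simp
  have S_smult: "smult (of_int m) P \<in> S" if "P \<in> S" for m P
  proof (induction m rule: int_induct[where k = 0])
    case base then show ?case using S_0 by simp
  next
    case (step1 i) then show ?case using S_add[OF _ that] by (simp add: smult_add_left)
  next
    case (step2 i) then show ?case using S_diff[OF _ that] by (simp add: smult_diff_left)
  qed
  have S_sum: "(\<Sum>k\<le>n. smult (c k) (binomial_poly k)) \<in> S" if "\<And>k. c k \<in> \<int>" for c and n :: nat
  proof -
    have "smult (c k) (binomial_poly k) \<in> S" for k
      using that[of k] S_smult[OF S_binom] by (auto elim!: Ints_cases)
    then show ?thesis by (induction n) (auto intro: S_add simp del: binomial_poly_0)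
  qed
  have S_all: "P \<in> S" if "P \<in> carrier int_valued_ring" for P
    using S_sum[of "\<lambda>k. newton_coeff k P" "degree P"] newton_coeff_Ints[OF that]
    by (simp add: newton_expansion[OF order_refl, symmetric])
  show ?thesis
  proof (rule additive_eqI[of h g])
    fix P c assume P: "P \<in> carrier int_valued_ring" "c \<in> carrier (residue_ring (int p))"
    have "pure_tensor int_valued_ring (residue_ring (int p)) P c = pure_tensor int_valued_ring (residue_ring (int p)) 1 c \<otimes>\<^bsub>Q\<^esub> reduce_mod p P"
      using pure_mult[of 1 P c 1] P one_Fp_carrier A.one_closed B.r_one[of c] by (simp add: one_Fp)
    then show "h (pure_tensor int_valued_ring (residue_ring (int p)) P c) = g (pure_tensor int_valued_ring (residue_ring (int p)) P c)"
      using S_all[OF P(1)] scale[OF P(2) pure_carrier[OF P(1) one_Fp_carrier]] by (simp add: S_def)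
  qed (use mem add X in \<open>simp_all add: tensor_algebra_simps\<close>)
qed

lemma frobenius_ex1:
  "\<exists>!\<Psi>. \<Psi> \<in> linear_maps (residue_ring (int p)) (int_valued_mod p) (int_valued_mod p) \<and>
     \<Psi> \<in> extensional (carrier (int_valued_mod p)) \<and>
     (\<forall>k. \<Psi> (reduce_mod p (binomial_poly k)) = reduce_mod p (binomial_poly (p * k)))"
  (is "\<exists>!\<Psi>. ?P \<Psi>")
proof (rule ex_ex1I)
  let ?f = "tensor_map int_valued_ring (residue_ring (int p)) (frobenius_lift p)"
  let ?\<Psi> = "restrict ?f (carrier (int_valued_mod p))"
  have f: "?f \<in> linear_maps (residue_ring (int p)) (int_valued_mod p) (int_valued_mod p)"
    by (rule tensor_map_linear) (auto simp: frobenius_lift_int_valued frobenius_lift_add)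
  have "module (residue_ring (int p)) (int_valued_mod p)" using tensor_algebra by (simp add: algebra_def)
  then have "?\<Psi> \<in> linear_maps (residue_ring (int p)) (int_valued_mod p) (int_valued_mod p)"
    using f unfolding linear_maps_def
    by (auto simp: module.smult_closed abelian_monoid.a_closed module_def abelian_group_def)
  moreover have "?\<Psi> (reduce_mod p (binomial_poly k)) = reduce_mod p (binomial_poly (p * k))" for k
  proof -
    have "?f (reduce_mod p (binomial_poly k)) = reduce_mod p (frobenius_lift p (binomial_poly k))"
      by (rule tensor_map_pure)
        (auto simp: frobenius_lift_int_valued frobenius_lift_add binomial_poly_int_valued one_Fp_carrier)
    then show ?thesis
      using pure_carrier[OF binomial_poly_int_valued one_Fp_carrier]
      by (simp add: frobenius_lift_binomial_poly tensor_algebra_simps)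
  qed
  ultimately show "\<exists>\<Psi>. ?P \<Psi>" by (intro exI[of _ ?\<Psi>]) auto
next
  fix \<Psi> \<Phi> assume *: "?P \<Psi>" "?P \<Phi>"
  show "\<Psi> = \<Phi>"
  proof (rule extensionalityI)
    show "\<Psi> X = \<Phi> X" if "X \<in> carrier (int_valued_mod p)" for X
      by (rule linear_eqI[OF _ _ _ that]) (use * in auto)
  qed (use * in auto)
qed

lemma shift_mod_linear: "shift_mod p \<in> linear_maps (residue_ring (int p)) (int_valued_mod p) (int_valued_mod p)"
  unfolding shift_mod_def
  by (rule tensor_map_linear) (auto simp: poly_shift_int_valued poly_shift_add)

lemma shift_mod_reduce_mod:
  "P \<in> carrier int_valued_ring \<Longrightarrow> shift_mod p (reduce_mod p P) = reduce_mod p (poly_shift P)"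
  unfolding shift_mod_def
  by (rule tensor_map_pure) (auto simp: poly_shift_int_valued poly_shift_add one_Fp_carrier)

lemma bar_mod_linear: "bar_mod p \<in> linear_maps (residue_ring (int p)) (int_valued_mod p) (int_valued_mod p)"
  unfolding bar_mod_def
  by (rule tensor_map_linear) (auto simp: poly_bar_int_valued poly_bar_add)

lemma bar_mod_reduce_mod:
  "P \<in> carrier int_valued_ring \<Longrightarrow> bar_mod p (reduce_mod p P) = reduce_mod p (poly_bar P)"
  unfolding bar_mod_def
  by (rule tensor_map_pure) (auto simp: poly_bar_int_valued poly_bar_add one_Fp_carrier)

lemmas frobenius_mod = theI'[OF frobenius_ex1, folded frobenius_mod_def]

end

end

theory Submission
  imports Defs "HOL-Computational_Algebra.Formal_Power_Series"
begin

text \<open>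
  The map \<open>S\<close> after the bar involution substitutes \<open>- 1 - x\<close> for \<open>x\<close>. Upper negation followed by
  Vandermonde's identity gives, already over the integers,
  \<open>(- 1 - x choose k) = (-1)\<^bsup>k\<^esup> (x + k choose k) = (-1)\<^bsup>k\<^esup> (\<Sum>j\<le>k. (k choose j) (x choose j))\<close>.
  So the reflection \<open>x \<mapsto> - 1 - x\<close> has, in the binomial basis, the matrix of signed binomial
  coefficients. Its commutation with \<open>\<Psi>\<close>, which maps the basis vector of index \<open>k\<close> to that of index
  \<open>p k\<close>, is a statement about these numbers modulo \<open>p\<close>: the row of index \<open>p k\<close> must be the row of
  index \<open>k\<close> with its entries moved from the columns \<open>j\<close> to the columns \<open>p j\<close> and zeros elsewhere. This
  is the reading, coefficient by coefficient, of \<open>(1 + X)\<^bsup>p k\<^esup> \<equiv> (1 + X\<^sup>p)\<^bsup>k\<^esup>\<close>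
  (\<open>binomial_prime_mult_cong\<close>), together with \<open>(-1)\<^bsup>p k\<^esup> \<equiv> (-1)\<^bsup>k\<^esup>\<close>. The congruence becomes an
  equality in the tensor product because \<open>p\<close> annihilates it (\<open>reduce_mod_sum_cong\<close>). Both sides are
  linear over the residue field, so that it is enough to compare them on the reduced binomial
  polynomials.
\<close>

section \<open>Binomial coefficients with upper index divisible by a prime\<close>

lemma binomial_prime_cong:
  assumes "prime (p::nat)"
  shows "[p choose j = (if j = 0 \<or> j = p then 1 else 0)] (mod p)"
proof (cases "0 < j \<and> j < p")
  case True
  then have "p dvd (p choose j)" using dvd_choose_prime[of j p] assms by auto
  then show ?thesis using True by (simp add: cong_0_iff)
qed (auto simp: binomial_eq_0)

text \<open>
  Comparing coefficients in \<open>(1 + X)\<^bsup>p (k + 1)\<^esup> \<equiv> (1 + X\<^sup>p) (1 + X)\<^bsup>p k\<^esup>\<close>: modulo \<open>p\<close> only the two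
  outer terms of Vandermonde's convolution survive.
\<close>

lemma binomial_prime_mult_Suc_cong:
  assumes "prime (p::nat)"
  shows "[(p * Suc k) choose i =
    ((p * k) choose i) + (if p \<le> i then (p * k) choose (i - p) else 0)] (mod p)"
proof -
  have p: "p \<noteq> 0" using assms by auto
  have "(p * Suc k) choose i = (\<Sum>j\<le>i. (p choose j) * ((p * k) choose (i - j)))"
    by (simp add: vandermonde)
  also have "[\<dots> = (\<Sum>j\<le>i. (if j = 0 \<or> j = p then 1 else 0) * ((p * k) choose (i - j)))] (mod p)"
    by (intro cong_sum cong_mult binomial_prime_cong[OF assms] cong_refl)
  also have "(\<Sum>j\<le>i. (if j = 0 \<or> j = p then 1 else 0) * ((p * k) choose (i - j))) =
      (\<Sum>j\<le>i. (if j = 0 then (p * k) choose (i - j) else 0) +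
                (if j = p then (p * k) choose (i - j) else 0))"
    by (rule sum.cong) (use p in auto)
  also have "\<dots> = ((p * k) choose i) + (if p \<le> i then (p * k) choose (i - p) else 0)"
    by (simp add: sum.distrib sum.delta)
  finally show ?thesis .
qed

lemma binomial_prime_mult_cong:
  assumes "prime (p::nat)"
  shows "[(p * k) choose i = (if p dvd i then k choose (i div p) else 0)] (mod p)"
proof (induction k arbitrary: i)
  case 0
  then show ?case by (cases "i = 0") (auto simp: dvd_div_eq_0_iff binomial_eq_0)
next
  case (Suc k)
  have p: "p > 0" using assms prime_gt_0_nat by blast
  let ?a = "\<lambda>k i. if p dvd i then k choose (i div p) else (0::nat)"
  have pascal: "?a k i + (if p \<le> i then ?a k (i - p) else 0) = ?a (Suc k) i"
  proof (cases "p \<le> i")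
    case True
    then have "i div p = Suc ((i - p) div p)" using p by (simp add: le_div_geq)
    then show ?thesis using True by (auto simp: dvd_minus_self)
  next
    case False
    then show ?thesis using p by (cases "i = 0") (auto dest: dvd_imp_le)
  qed
  have "[(p * Suc k) choose i =
      ((p * k) choose i) + (if p \<le> i then (p * k) choose (i - p) else 0)] (mod p)"
    by (rule binomial_prime_mult_Suc_cong[OF assms])
  also have "[((p * k) choose i) + (if p \<le> i then (p * k) choose (i - p) else 0) =
      ?a k i + (if p \<le> i then ?a k (i - p) else 0)] (mod p)"
    using cong_add[OF Suc Suc, of i "i - p"] Suc[of i] by (cases "p \<le> i") auto
  finally show ?case by (simp only: pascal)
qed

lemma minus_one_power_prime_mult_cong:
  assumes "prime (p::nat)"
  shows "[(- 1) ^ (p * k) = (- 1 :: int) ^ k] (mod int p)"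
proof (cases "p = 2")
  case True
  \<comment> \<open>The exponents may differ in parity here, but modulo 2 the sign does not matter.\<close>
  then show ?thesis
    by (cases "even k") (simp_all add: cong_def)
next
  case False
  then have "odd p" using assms primes_dvd_imp_eq two_is_prime_nat by blast
  then show ?thesis by (simp add: power_mult)
qed


section \<open>The reflection in the binomial basis\<close>

lemma reflect_binomial_poly:
  "poly_shift (poly_bar (binomial_poly k)) =
    (\<Sum>j\<le>k. smult (of_int ((- 1) ^ k * int (k choose j))) (binomial_poly j))"
proof (intro poly_eq_poly_eq_iff[THEN iffD1] ext)
  fix x :: rat
  have "poly (poly_shift (poly_bar (binomial_poly k))) x = (- 1 - x) gchoose k"
    by (simp add: poly_shift_def poly_bar_def poly_pcompose poly_binomial_poly)
  also have "\<dots> = (- 1) ^ k * ((x + of_nat k) gchoose k)"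
    by (subst gbinomial_negated_upper) (simp add: algebra_simps)
  also have "(x + of_nat k) gchoose k =
      (\<Sum>j\<le>k. (x gchoose j) * (of_nat k gchoose (k - j)))"
    by (rule gbinomial_Vandermonde[symmetric, unfolded atLeast0AtMost])
  also have "\<dots> = (\<Sum>j\<le>k. of_nat (k choose j) * (x gchoose j))"
    by (rule sum.cong) (auto simp flip: binomial_gbinomial binomial_symmetric)
  finally show "poly (poly_shift (poly_bar (binomial_poly k))) x =
      poly (\<Sum>j\<le>k. smult (of_int ((- 1) ^ k * int (k choose j))) (binomial_poly j)) x"
    by (simp add: poly_sum poly_binomial_poly sum_distrib_left mult.assoc)
qed

lemma frobenius_lift_sum_binomial_poly:
  "frobenius_lift p (\<Sum>j\<le>n. smult (c j) (binomial_poly j)) =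
    (\<Sum>j\<le>n. smult (c j) (binomial_poly (p * j)))"
proof -
  let ?P = "\<Sum>j\<le>n. smult (c j) (binomial_poly j)"
  have "degree ?P \<le> n"
    by (intro degree_sum_le) (auto intro: order_trans[OF degree_smult_le] simp: degree_binomial_poly)
  moreover have "newton_coeff k ?P = c k" if "k \<le> n" for k
    using that by (simp add: newton_coeff_sum newton_coeff_smult newton_coeff_binomial_poly
        if_distrib sum.delta cong: if_cong)
  ultimately show ?thesis by (simp add: frobenius_lift_eq)
qed

text \<open>Listing the image with all indices up to \<open>p k\<close> makes it comparable term by term with the
  reflection of the binomial polynomial of index \<open>p k\<close>.\<close>

lemma frobenius_lift_reflect_binomial_poly:
  assumes "p > 0"
  shows "frobenius_lift p (poly_shift (poly_bar (binomial_poly k))) =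
    (\<Sum>i\<le>p * k. smult (of_int ((- 1) ^ k * int (if p dvd i then k choose (i div p) else 0)))
       (binomial_poly i))"
proof -
  let ?g = "\<lambda>i. smult (of_int ((- 1) ^ k * int (if p dvd i then k choose (i div p) else 0)))
       (binomial_poly i)"
  have "(\<Sum>i\<le>p * k. ?g i) = (\<Sum>i\<in>(*) p ` {..k}. ?g i)"
    by (rule sum.mono_neutral_right) (use assms in \<open>auto elim!: dvdE\<close>)
  also have "\<dots> = (\<Sum>j\<le>k. ?g (p * j))"
    by (subst sum.reindex) (use assms in \<open>auto simp: inj_on_def\<close>)
  finally show ?thesis
    using assms by (simp add: reflect_binomial_poly frobenius_lift_sum_binomial_poly)
qed


section \<open>Congruences become equalities after reduction\<close>

lemma linear_maps_comp:
  assumes "f \<in> linear_maps R M N" "g \<in> linear_maps R L M"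
  shows "(\<lambda>x. f (g x)) \<in> linear_maps R L N"
  using assms by (auto simp: linear_maps_def Pi_iff)

context
  fixes p :: nat
  assumes p: "prime p"
begin

interpretation two_crings int_valued_ring "residue_ring (int p)"
  by (rule two_crings_mod[OF p])

lemma reduce_mod_smult_of_nat:
  assumes P: "P \<in> carrier int_valued_ring"
  shows "reduce_mod p (smult (of_nat n) P) =
    pure_tensor int_valued_ring (residue_ring (int p)) P (int n mod int p)"
proof (induction n)
  case 0
  let ?t = "pure_tensor int_valued_ring (residue_ring (int p))"
  have z: "\<zero>\<^bsub>residue_ring (int p)\<^esub> = 0" by (simp add: residue_ring_def)
  have "?t 0 1 \<oplus>\<^bsub>Q\<^esub> ?t 0 1 = ?t 0 1"
    using pure_add_left[of 0 0 1] A.zero_closed one_Fp_carrier[OF p] by simp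
  then have "?t 0 1 = \<zero>\<^bsub>Q\<^esub>"
    using pure_carrier[of 0 1] A.zero_closed one_Fp_carrier[OF p] by (simp add: Q.add.r_cancel_one)
  moreover have "?t P 0 \<oplus>\<^bsub>Q\<^esub> ?t P 0 = ?t P 0"
    using pure_add_right[of P "\<zero>\<^bsub>residue_ring (int p)\<^esub>" "\<zero>\<^bsub>residue_ring (int p)\<^esub>"] P by (simp add: z[symmetric])
  then have "?t P 0 = \<zero>\<^bsub>Q\<^esub>"
    using pure_carrier[of P 0] B.zero_closed P by (simp add: z Q.add.r_cancel_one)
  ultimately show ?case by simp
next
  case (Suc n)
  have nP: "smult (of_nat n) P \<in> carrier int_valued_ring"
    using P by (auto simp: int_valued_iff)
  have c: "int n mod int p \<in> carrier (residue_ring (int p))"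
    using p prime_gt_0_nat[of p] by (simp add: residue_ring_def)
  have a: "1 \<oplus>\<^bsub>residue_ring (int p)\<^esub> (int n mod int p) = int (Suc n) mod int p"
    by (simp add: residue_ring_def mod_simps)
  have "reduce_mod p (smult (of_nat (Suc n)) P) = reduce_mod p (P \<oplus>\<^bsub>int_valued_ring\<^esub> smult (of_nat n) P)"
    by (simp add: smult_add_left)
  also have "\<dots> = reduce_mod p P \<oplus>\<^bsub>Q\<^esub> reduce_mod p (smult (of_nat n) P)"
    by (rule pure_add_left[OF P nP one_Fp_carrier[OF p]])
  also have "\<dots> = pure_tensor int_valued_ring (residue_ring (int p)) P (int (Suc n) mod int p)"
    unfolding Suc.IH a[symmetric] by (rule pure_add_right[OF P one_Fp_carrier[OF p] c, symmetric])
  finally show ?case .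
qed

lemma reduce_mod_add_prime_smult:
  assumes P: "P \<in> carrier int_valued_ring" and D: "D \<in> carrier int_valued_ring"
  shows "reduce_mod p (P + smult (of_nat p) D) = reduce_mod p P"
proof -
  have pD: "smult (of_nat p) D \<in> carrier int_valued_ring"
    using D by (auto simp: int_valued_iff)
  \<comment> \<open>The multiples of \<open>D\<close> by \<open>p\<close> and by 0 both go to the tensor of \<open>D\<close> with the residue 0.\<close>
  have "reduce_mod p (smult (of_nat p) D) = reduce_mod p 0"
    using reduce_mod_smult_of_nat[OF D, of p] reduce_mod_smult_of_nat[OF D, of 0] by simp
  then have "reduce_mod p (P + smult (of_nat p) D) = reduce_mod p (P + 0)"
    using pure_add_left[OF P pD one_Fp_carrier[OF p]]
      pure_add_left[OF P A.zero_closed one_Fp_carrier[OF p]] by simp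
  then show ?thesis by simp
qed

lemma reduce_mod_sum_cong:
  assumes F: "\<And>i. i \<in> J \<Longrightarrow> F i \<in> carrier int_valued_ring"
    and cong: "\<And>i. i \<in> J \<Longrightarrow> [c i = d i] (mod int p)"
  shows "reduce_mod p (\<Sum>i\<in>J. smult (of_int (c i)) (F i)) =
    reduce_mod p (\<Sum>i\<in>J. smult (of_int (d i)) (F i))"
proof -
  have "\<exists>m. \<forall>i\<in>J. c i = d i + int p * m i"
    using cong by (intro bchoice) (metis cong_iff_lin cong_sym)
  then obtain m where m: "\<And>i. i \<in> J \<Longrightarrow> c i = d i + int p * m i" by blast
  let ?D = "\<Sum>i\<in>J. smult (of_int (m i)) (F i)"
  have smult_D: "smult (of_nat p) ?D = (\<Sum>i\<in>J. smult (of_nat p) (smult (of_int (m i)) (F i)))"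
    by (induction J rule: infinite_finite_induct) (simp_all add: smult_add_right)
  have "(\<Sum>i\<in>J. smult (of_int (c i)) (F i)) =
      (\<Sum>i\<in>J. smult (of_int (d i)) (F i) + smult (of_nat p) (smult (of_int (m i)) (F i)))"
    by (rule sum.cong) (simp_all add: m smult_add_left)
  also have "\<dots> = (\<Sum>i\<in>J. smult (of_int (d i)) (F i)) + smult (of_nat p) ?D"
    by (simp only: sum.distrib smult_D)
  finally show ?thesis
    using F by (simp only: reduce_mod_add_prime_smult int_valued_sum Ints_of_int)
qed


section \<open>The Frobenius map commutes with the reflection\<close>

text \<open>The Frobenius map is only characterized by its values on the reduced basis; its integral lift
  computes it on the reduction of every integer-valued polynomial.\<close>

lemma frobenius_mod_reduce_mod:
  assumes P: "P \<in> carrier int_valued_ring"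
  shows "frobenius_mod p (reduce_mod p P) = reduce_mod p (frobenius_lift p P)"
proof -
  let ?f = "tensor_map int_valued_ring (residue_ring (int p)) (frobenius_lift p)"
  have f_lin: "?f \<in> linear_maps (residue_ring (int p)) (int_valued_mod p) (int_valued_mod p)"
    by (rule tensor_map_linear) (auto simp: frobenius_lift_int_valued frobenius_lift_add)
  have f_reduce: "?f (reduce_mod p R) = reduce_mod p (frobenius_lift p R)"
    if "R \<in> carrier int_valued_ring" for R
    by (rule tensor_map_pure)
       (use that in \<open>auto simp: frobenius_lift_int_valued frobenius_lift_add one_Fp_carrier[OF p]\<close>)
  have "frobenius_mod p (reduce_mod p P) = ?f (reduce_mod p P)"
  proof (rule linear_eqI[OF p _ f_lin])
    show "frobenius_mod p \<in> linear_maps (residue_ring (int p)) (int_valued_mod p) (int_valued_mod p)"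
      using frobenius_mod[OF p] by blast
    show "frobenius_mod p (reduce_mod p (binomial_poly k)) = ?f (reduce_mod p (binomial_poly k))" for k
      using frobenius_mod[OF p]
      by (simp add: f_reduce binomial_poly_int_valued frobenius_lift_binomial_poly)
    show "reduce_mod p P \<in> carrier (int_valued_mod p)"
      by (simp add: tensor_algebra_simps pure_carrier P one_Fp_carrier[OF p])
  qed
  then show ?thesis using f_reduce[OF P] by simp
qed

lemma reduce_mod_reflect_frobenius:
  "reduce_mod p (frobenius_lift p (poly_shift (poly_bar (binomial_poly k)))) =
    reduce_mod p (poly_shift (poly_bar (binomial_poly (p * k))))"
proof -
  have pos: "p > 0" using p prime_gt_0_nat by blast
  show ?thesis
    unfolding frobenius_lift_reflect_binomial_poly[OF pos] reflect_binomial_poly[of "p * k"]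
  proof (rule reduce_mod_sum_cong)
    fix i
    have "[int (if p dvd i then k choose (i div p) else 0) = int ((p * k) choose i)] (mod int p)"
      using binomial_prime_mult_cong[OF p, of k i] by (simp only: cong_int_iff cong_sym_eq)
    then show "[(- 1) ^ k * int (if p dvd i then k choose (i div p) else 0) =
        (- 1) ^ (p * k) * int ((p * k) choose i)] (mod int p)"
      by (rule cong_mult[OF cong_sym[OF minus_one_power_prime_mult_cong[OF p]]])
  qed (rule binomial_poly_int_valued)
qed

end

theorem proposition7p3:
  fixes p :: nat and P :: "(rat poly \<times> int \<Rightarrow>\<^sub>0 int) set"
  assumes "prime p"
    and "P \<in> carrier (int_valued_mod p)"
  shows "frobenius_mod p (shift_mod p (bar_mod p P)) = shift_mod p (bar_mod p (frobenius_mod p P))"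
proof -
  note lin = bar_mod_linear[OF assms(1)] shift_mod_linear[OF assms(1)]
  have frob: "frobenius_mod p \<in> linear_maps (residue_ring (int p)) (int_valued_mod p) (int_valued_mod p)"
    "\<And>k. frobenius_mod p (reduce_mod p (binomial_poly k)) = reduce_mod p (binomial_poly (p * k))"
    using frobenius_mod[OF assms(1)] by blast+
  have reflect: "shift_mod p (bar_mod p (reduce_mod p (binomial_poly k))) =
      reduce_mod p (poly_shift (poly_bar (binomial_poly k)))" for k
    by (simp add: bar_mod_reduce_mod shift_mod_reduce_mod assms(1) binomial_poly_int_valued
        poly_bar_int_valued)
  show ?thesis
  proof (rule linear_eqI[OF assms(1) _ _ _ assms(2),
        where h = "\<lambda>X. frobenius_mod p (shift_mod p (bar_mod p X))"
          and g = "\<lambda>X. shift_mod p (bar_mod p (frobenius_mod p X))"])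
    show "(\<lambda>X. frobenius_mod p (shift_mod p (bar_mod p X))) \<in>
        linear_maps (residue_ring (int p)) (int_valued_mod p) (int_valued_mod p)"
      by (intro linear_maps_comp[OF frob(1)] linear_maps_comp[OF lin(2)] lin(1))
    show "(\<lambda>X. shift_mod p (bar_mod p (frobenius_mod p X))) \<in>
        linear_maps (residue_ring (int p)) (int_valued_mod p) (int_valued_mod p)"
      by (intro linear_maps_comp[OF lin(2)] linear_maps_comp[OF lin(1)] frob(1))
    show "frobenius_mod p (shift_mod p (bar_mod p (reduce_mod p (binomial_poly k)))) =
        shift_mod p (bar_mod p (frobenius_mod p (reduce_mod p (binomial_poly k))))" for k
      using reduce_mod_reflect_frobenius[OF assms(1), of k]
      by (simp add: reflect frob(2) frobenius_mod_reduce_mod assms(1) poly_shift_int_valued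
          poly_bar_int_valued binomial_poly_int_valued)
  qed
qed

end
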